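(* Let $T_n=2^{2^n}$ for integers $n\ge 0$, and let $a_n=1$ if $n$ is even and $a_n=2$ if $n$ is odd. Define $a:[0,\infty)\to[1,2]$ by $a(t)=1$ for $0\le t<T_0$ and $a(t)=a_n$ for $T_n\le t<T_{n+1}$, $n\ge 0$. Define $w(x)=1$ for $0\le x\le 1$ and $w(x)=a(\log x)$ for $x>1$. Equip $X=[0,\infty)$ with the Euclidean metric and the measure $d\mu(x)=w(x)\,dx$, and take $\alpha=1$. Then the metric measure space $(X,|\cdot|,\mu)$ is $1$-Ahlfors regular. Moreover, for $u(x)=(1-x)_+=\max\{1-x,0\}$ and every $1\le p<\infty$, there are two decreasing sequences of positive numbers $s$ tending to $0$ along which $\mathcal E_s(u)$ converges respectively to $$\frac{2}{p(p+1)}\qquad\text{and}\qquad \frac{4}{p(p+1)}.$$ Consequently, neither the limit $\lim_{s\downarrow0}\mathcal E_s(u)$ nor, for a base point $o\in X$, the logarithmic-volume mean $$\lim_{R\to\infty}\frac1{\log R}\int_1^R\frac{\mu(B_r(o))}{r}\,\frac{dr}{r}$$ exists.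
   Context: Balls are closed: $B_r(x)=\{y\in X:|x-y|\le r\}$. A metric measure space $(X,d,\mu)$ is $\alpha$-Ahlfors regular if there are constants $0<c\le C<\infty$ such that $c r^\alpha\le\mu(B_r(x))\le C r^\alpha$ for all $x\in X$ and $r>0$. For $s>0$ and $1\le p<\infty$ (here with $\alpha=1$), $$\mathcal E_s(u)=s\iint_{x\ne y}\frac{|u(x)-u(y)|^p}{|x-y|^{1+sp}}\,d\mu(x)\,d\mu(y).$$ *)

theory Defs
  imports "HOL-Analysis.Analysis"
begin

text \<open>A metric measure space is a Borel measure \<open>M\<close> whose underlying set is \<open>space M\<close>, a subset of
  an ambient metric type, with the restricted distance.\<close>

definition metric_measure_space :: "'a::metric_space measure \<Rightarrow> bool" where
  "metric_measure_space M \<longleftrightarrow> sets M = sets (restrict_space borel (space M))"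

definition mball_of :: "'a::metric_space measure \<Rightarrow> 'a \<Rightarrow> real \<Rightarrow> 'a set" where
  "mball_of M x r = {y \<in> space M. dist x y \<le> r}"

definition ahlfors_regular :: "real \<Rightarrow> 'a::metric_space measure \<Rightarrow> bool" where
  "ahlfors_regular \<alpha> M \<longleftrightarrow> metric_measure_space M \<and>
     (\<exists>c C. 0 < c \<and> c \<le> C \<and>
        (\<forall>x\<in>space M. \<forall>r>0.
           ennreal (c * r powr \<alpha>) \<le> emeasure M (mball_of M x r) \<and>
           emeasure M (mball_of M x r) \<le> ennreal (C * r powr \<alpha>)))"

text \<open>The energy takes values in \<open>[0, \<infinity>]\<close>; the dimension in the exponent is \<open>\<alpha> = 1\<close>.\<close>

definition energy :: "'a::metric_space measure \<Rightarrow> real \<Rightarrow> real \<Rightarrow> ('a \<Rightarrow> real) \<Rightarrow> ennreal" where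
  "energy M p s u = ennreal s *
     (\<integral>\<^sup>+z\<in>{(x, y). x \<noteq> y}.
        (case z of (x, y) \<Rightarrow> ennreal (\<bar>u x - u y\<bar> powr p / dist x y powr (1 + s * p)))
      \<partial>(M \<Otimes>\<^sub>M M))"

definition log_volume_mean :: "'a::metric_space measure \<Rightarrow> 'a \<Rightarrow> real \<Rightarrow> real" where
  "log_volume_mean M x\<^sub>0 R =
     1 / ln R * (LINT r:{1..R}|lborel. measure M (mball_of M x\<^sub>0 r) / r * (1 / r))"

definition T :: "nat \<Rightarrow> real" where
  "T n = 2 ^ (2 ^ n)"

definition a_seq :: "nat \<Rightarrow> real" where
  "a_seq n = (if even n then 1 else 2)"

definition a_fun :: "real \<Rightarrow> real" where
  "a_fun t = (if t < T 0 then 1 else a_seq (THE n. T n \<le> t \<and> t < T (Suc n)))"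

definition w :: "real \<Rightarrow> real" where
  "w x = (if x \<le> 1 then 1 else a_fun (ln x))"

definition \<mu> :: "real measure" where
  "\<mu> = density (restrict_space lborel {0..}) (\<lambda>x. ennreal (w x))"

definition u :: "real \<Rightarrow> real" where
  "u x = max (1 - x) 0"

lemma T_strict_mono: "strict_mono T"
  by (simp add: strict_mono_def T_def)

text \<open>The description in \<^term>\<open>a_fun\<close> always denotes.\<close>

lemma ex1_T_interval:
  assumes "T 0 \<le> t"
  shows "\<exists>!n. T n \<le> t \<and> t < T (Suc n)"
proof -
  have "\<exists>n. t < T n"
  proof -
    obtain m where m: "t < 2 ^ m"
      using real_arch_pow[of 2 t] by auto
    have "(2::real) ^ m \<le> T m"
      unfolding T_def by (intro power_increasing) (auto simp: less_imp_le)
    with m show ?thesis by (intro exI[of _ m]) linarith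
  qed
  then obtain k where k: "t < T k" by blast
  define N where "N = (LEAST n. t < T n)"
  have N: "t < T N" unfolding N_def using k by (rule LeastI)
  with assms have "N \<noteq> 0" by (metis not_le)
  then obtain n where n: "N = Suc n" by (cases N) auto
  have "\<not> t < T n" using n not_less_Least[of n "\<lambda>n. t < T n"] by (simp add: N_def)
  moreover have "m = n'" if "T m \<le> t" "t < T (Suc m)" "T n' \<le> t" "t < T (Suc n')" for m n'
  proof -
    have "m < Suc n'" "n' < Suc m"
      using that T_strict_mono by (meson le_less_trans strict_mono_less)+
    then show ?thesis by simp
  qed
  ultimately show ?thesis using N n by (metis not_le)
qed

lemma a_fun_eq:
  assumes "T n \<le> t" "t < T (Suc n)"
  shows "a_fun t = a_seq n"
proof -
  have "T 0 \<le> T n" using T_strict_mono by (simp add: strict_mono_less_eq)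
  with assms(1) have t: "T 0 \<le> t" by linarith
  have "(THE n. T n \<le> t \<and> t < T (Suc n)) = n"
    using ex1_T_interval[OF t] assms by (intro the1_equality) auto
  with t show ?thesis by (simp add: a_fun_def)
qed

lemma space_mu: "space \<mu> = {0..}"
  by (simp add: \<mu>_def space_restrict_space)

end

theory Submission imports Defs begin

text \<open>
  Both the energy for small \<open>s\<close> and the logarithmic volume mean are averages of the weight over the
  logarithmic variable \<open>t = ln y\<close>: an Abel mean with kernel \<open>q * exp (- q * t)\<close>, \<open>q = s * p\<close>, for the
  energy, and a Cesaro mean over \<open>[0, ln R]\<close> for the volumes. The function \<^const>\<open>a_fun\<close> alternates between
  \<open>1\<close> and \<open>2\<close> on intervals \<open>[T n, T (Suc n))\<close> so long that either mean, taken at a scale well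
  inside one of them, sees only the value on that interval. Both means therefore have \<open>1\<close>
  and \<open>2\<close> as limit points.

  To reduce the energy to an Abel mean, note that \<^const>\<open>u\<close> vanishes beyond \<open>1\<close>. Pairs of points in
  \<open>[0, 2]\<^sup>2\<close> contribute \<open>O(s)\<close>, because \<^const>\<open>u\<close> is Lipschitz and so the singularity of the kernel
  on the diagonal is integrable uniformly in \<open>s\<close>. What remains are the pairs with one point \<open>x \<le> 1\<close> and
  the other point \<open>y\<close> far away; there \<open>\<bar>x - y\<bar>\<close> may be replaced by \<open>y\<close> up to another \<open>O(s)\<close>, and the
  double integral factors into \<open>\<integral> u\<^sup>p d\<mu> = 1 / (p + 1)\<close> and the moment of \<open>y powr (- 1 - q)\<close>. By symmetry the
  energy is \<open>2 / (p * (p + 1))\<close> times the Abel mean, up to \<open>O(s)\<close> (\<open>energy_lower\<close>, \<open>energy_upper\<close>).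

  The common choice of scale is \<open>1 / q = ln R = T m * T (Suc m)\<close>, and \<open>pareto_moment_bounds\<close> and
  \<open>log_volume_mean_near\<close> estimate the two means there. Sequences of even and of odd \<open>m\<close> then give the
  two limit values. Ahlfors regularity holds because the weight stays between \<open>1\<close> and \<open>2\<close>.
\<close>

section \<open>The scales and the weight\<close>

lemma T_Suc: "T (Suc n) = T n ^ 2"
  by (simp add: T_def power_mult[symmetric] mult.commute)

lemma T_ge_2: "2 \<le> T n"
proof -
  have "(2::real) ^ 1 \<le> 2 ^ (2 ^ n)" by (intro power_increasing) auto
  then show ?thesis by (simp add: T_def)
qed

lemma filterlim_T: "filterlim T at_top sequentially"
proof (rule filterlim_at_top_mono[OF filterlim_real_sequentially always_eventually], rule allI)
  fix n
  have "real n \<le> 2 ^ n" by (rule less_imp_le[OF of_nat_less_two_power])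
  also have "(2::real) ^ n \<le> T n"
    unfolding T_def by (intro power_increasing) (auto simp: less_imp_le)
  finally show "real n \<le> T n" .
qed

lemma ln_less_iff_less_exp: "0 < x \<Longrightarrow> ln x < t \<longleftrightarrow> x < exp (t::real)"
  by (metis exp_less_cancel_iff exp_ln)

text \<open>The exponentials of the odd intervals carry the value \<open>2\<close> and everything else the value \<open>1\<close>.
  In this form measurability and the bounds of \<^const>\<open>w\<close> are immediate, and the description
  operator in \<^const>\<open>a_fun\<close> is dealt with once and for all.\<close>

lemma w_eq_one_plus_indicator:
  "w x = 1 + indicator (\<Union>n\<in>{n. odd n}. {exp (T n)..<exp (T (Suc n))}) x"
proof (cases "1 < x \<and> T 0 \<le> ln x")
  case False
  have "x < exp (T n)" for n
  proof (cases "1 < x")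
    case True
    have "T 0 \<le> T n" using T_strict_mono by (simp add: strict_mono_less_eq)
    with False True have "ln x < T n" by auto
    with True show ?thesis by (metis exp_less_mono exp_ln less_trans zero_less_one)
  next
    case False
    have "1 < exp (T n)" using T_ge_2[of n] by simp
    with False show ?thesis by linarith
  qed
  with False show ?thesis
    by (auto simp: w_def a_fun_def not_le indicator_def)
next
  case True
  then obtain n where n: "T n \<le> ln x" "ln x < T (Suc n)"
    using ex1_T_interval[of "ln x"] by auto
  have mem: "x \<in> {exp (T k)..<exp (T (Suc k))} \<longleftrightarrow> T k \<le> ln x \<and> ln x < T (Suc k)" for k
    using True by (auto simp: ln_ge_iff ln_less_iff_less_exp)
  have "T k \<le> ln x \<and> ln x < T (Suc k) \<longleftrightarrow> k = n" for k
    using ex1_T_interval[of "ln x"] True n by auto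
  then have "x \<in> (\<Union>n\<in>{n. odd n}. {exp (T n)..<exp (T (Suc n))}) \<longleftrightarrow> odd n"
    using mem by simp
  moreover have "w x = a_seq n" using True n by (simp add: w_def a_fun_eq)
  ultimately show ?thesis by (simp add: a_seq_def)
qed

lemma borel_measurable_w [measurable]: "w \<in> borel_measurable borel"
  unfolding w_eq_one_plus_indicator[abs_def] by measurable

lemma w_bounds: "1 \<le> w x" "w x \<le> 2"
  by (auto simp: w_eq_one_plus_indicator indicator_def)

lemma w_nonneg [simp]: "0 \<le> w x"
  using w_bounds(1)[of x] by simp

lemma a_seq_bounds: "1 \<le> a_seq n" "a_seq n \<le> 2"
  by (auto simp: a_seq_def)

lemma w_eq_a_seq:
  assumes "exp (T n) \<le> x" "x < exp (T (Suc n))"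
  shows "w x = a_seq n"
proof -
  have "1 < exp (T n)" using T_ge_2[of n] by simp
  with assms(1) have "1 < x" by linarith
  moreover have "T n \<le> ln x" "ln x < T (Suc n)"
    using assms \<open>1 < x\<close> by (auto simp: ln_ge_iff ln_less_iff_less_exp)
  ultimately show ?thesis by (simp add: w_def a_fun_eq)
qed

section \<open>Integration against the weighted measure\<close>

lemma sets_mu: "sets \<mu> = sets (restrict_space borel {0..})"
  by (simp add: \<mu>_def sets_restrict_space)

lemma measurable_mu_of_borel [measurable (raw)]:
  "f \<in> measurable borel N \<Longrightarrow> f \<in> measurable \<mu> N"
  by (simp add: measurable_cong_sets[OF sets_mu refl] measurable_restrict_space1)

lemma nn_integral_mu:
  assumes [measurable]: "f \<in> borel_measurable borel"
  shows "(\<integral>\<^sup>+x. f x \<partial>\<mu>) = (\<integral>\<^sup>+x. ennreal (w x) * f x * indicator {0..} x \<partial>lborel)"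
  unfolding \<mu>_def
  by (subst nn_integral_density)
     (auto simp: nn_integral_restrict_space intro!: measurable_restrict_space1)

lemma sigma_finite_mu: "sigma_finite_measure \<mu>"
proof -
  interpret R: sigma_finite_measure "restrict_space lborel {0::real..}"
    by (rule sigma_finite_measure_restrict_space[OF sigma_finite_lborel]) auto
  show ?thesis
    unfolding \<mu>_def
    by (subst R.sigma_finite_iff_density_finite) (auto intro!: measurable_restrict_space1)
qed

text \<open>\<^const>\<open>\<mu>\<close> lives on the trace of the Borel algebra on the half-line, not on the Borel
  algebra itself; these rules let functions of the plane be treated as measurable without mention of
  that trace.\<close>

lemma measurable_pair_mu [measurable]:
  "fst \<in> borel_measurable (\<mu> \<Otimes>\<^sub>M \<mu>)" "snd \<in> borel_measurable (\<mu> \<Otimes>\<^sub>M \<mu>)"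
  using measurable_compose[OF measurable_fst measurable_mu_of_borel[OF measurable_ident]]
        measurable_compose[OF measurable_snd measurable_mu_of_borel[OF measurable_ident]]
  by auto

lemma nn_integral_product_mu:
  fixes f g :: "real \<Rightarrow> ennreal"
  assumes [measurable]: "f \<in> borel_measurable borel" "g \<in> borel_measurable borel"
  shows "(\<integral>\<^sup>+z. f (fst z) * g (snd z) \<partial>(\<mu> \<Otimes>\<^sub>M \<mu>)) = (\<integral>\<^sup>+x. f x \<partial>\<mu>) * (\<integral>\<^sup>+y. g y \<partial>\<mu>)"
proof -
  interpret sigma_finite_measure \<mu> by (rule sigma_finite_mu)
  have "(\<integral>\<^sup>+z. f (fst z) * g (snd z) \<partial>(\<mu> \<Otimes>\<^sub>M \<mu>)) = (\<integral>\<^sup>+x. (\<integral>\<^sup>+y. f x * g y \<partial>\<mu>) \<partial>\<mu>)"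
    by (subst nn_integral_fst[symmetric]) auto
  also have "\<dots> = (\<integral>\<^sup>+x. f x \<partial>\<mu>) * (\<integral>\<^sup>+y. g y \<partial>\<mu>)"
    by (simp add: nn_integral_cmult nn_integral_multc)
  finally show ?thesis .
qed

section \<open>Weighted moments of power tails\<close>

text \<open>The radial kernel \<open>y\<^sup>-\<^sup>1\<^sup>-\<^sup>q\<close> beyond the point \<open>c\<close>: up to the factor \<open>q c\<^sup>q\<close> this is the
  density of a Pareto distribution. After the substitution \<open>y = exp t\<close> its integral against
  \<^const>\<open>w\<close> is a Laplace transform of \<^const>\<open>a_fun\<close>.\<close>

definition pareto :: "real \<Rightarrow> real \<Rightarrow> real \<Rightarrow> real" where
  "pareto q c y = indicator {c..} y * y powr (-1 - q)"

lemma borel_measurable_pareto [measurable]: "pareto q c \<in> borel_measurable borel"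
  unfolding pareto_def[abs_def] by measurable

lemma pareto_nonneg [simp]: "0 \<le> pareto q c y"
  by (simp add: pareto_def)

lemma powr_neg_one_minus: "x powr (-1 - q) = 1 / x powr (1 + q)" for x q :: real
  using powr_minus_divide[of x "1 + q"] by simp

lemma nn_integral_pareto:
  assumes "0 < q" "0 < c"
  shows "(\<integral>\<^sup>+y. ennreal (pareto q c y) \<partial>lborel) = ennreal (c powr (- q) / q)"
proof -
  have "(\<integral>\<^sup>+y. ennreal (pareto q c y) \<partial>lborel)
      = (\<integral>\<^sup>+y. ennreal (y powr (-1 - q)) * indicator {c..} y \<partial>lborel)"
    by (intro nn_integral_cong) (simp add: pareto_def indicator_def)
  also have "\<dots> = ennreal (c powr (- q) / q)"
    using has_integral_powr_to_inf[of "-1 - q" c] assms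
    by (intro nn_integral_has_integral_lebesgue') auto
  finally show ?thesis .
qed

lemma nn_integral_mu_pareto:
  assumes "0 \<le> c"
  shows "(\<integral>\<^sup>+y. ennreal (pareto q c y) \<partial>\<mu>) = (\<integral>\<^sup>+y. ennreal (w y * pareto q c y) \<partial>lborel)"
  using assms
  by (subst nn_integral_mu)
     (auto intro!: nn_integral_cong simp: ennreal_mult' pareto_def indicator_def)

lemma nn_integral_mu_pareto_le:
  assumes "0 < q"
  shows "(\<integral>\<^sup>+y. ennreal (pareto q 1 y) \<partial>\<mu>) \<le> ennreal (2 / q)"
proof -
  have "(\<integral>\<^sup>+y. ennreal (w y * pareto q 1 y) \<partial>lborel)
      \<le> (\<integral>\<^sup>+y. ennreal 2 * ennreal (pareto q 1 y) \<partial>lborel)"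
    by (intro nn_integral_mono, subst ennreal_mult[symmetric])
       (auto intro!: ennreal_leI mult_right_mono w_bounds(2))
  also have "\<dots> = ennreal 2 * ennreal (1 / q)"
    using assms nn_integral_pareto[of q 1] by (subst nn_integral_cmult) auto
  also have "\<dots> = ennreal (2 / q)"
    using assms by (subst ennreal_mult[symmetric]) auto
  finally show ?thesis by (simp add: nn_integral_mu_pareto)
qed

text \<open>The weight equals \<open>a_seq n\<close> between \<open>A = exp (T n)\<close> and \<open>B = exp (T (Suc n))\<close> and lies in \<open>[1, 2]\<close>
  elsewhere. The Pareto mass outside \<open>[A, B)\<close> is \<open>1 - \<alpha> + \<beta>\<close> after multiplication by \<open>q\<close>, so the moment is close
  to \<open>a_seq n\<close> as soon as \<open>q * T n\<close> is small while \<open>q * T (Suc n)\<close> is large. Both bounds come from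
  pointwise inequalities between combinations of tails with nonnegative coefficients, so that no
  subtraction of possibly infinite integrals occurs.\<close>

lemma pareto_moment_bounds:
  fixes q :: real and n :: nat
  assumes "0 < q"
  defines "J \<equiv> (\<integral>\<^sup>+y. ennreal (pareto q 1 y) \<partial>\<mu>)"
    and "\<alpha> \<equiv> exp (- q * T n)" and "\<beta> \<equiv> exp (- q * T (Suc n))"
  shows "ennreal (a_seq n * \<alpha> - \<beta>) \<le> ennreal q * J"
    and "ennreal q * J \<le> ennreal (a_seq n + 1 - \<alpha> + \<beta>)"
proof -
  define A B where "A = exp (T n)" and "B = exp (T (Suc n))"
  let ?a = "a_seq n"
  have tail: "(\<integral>\<^sup>+y. ennreal (pareto q (exp t) y) \<partial>lborel) = ennreal (exp (- q * t) / q)" for t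
    using assms(1) by (simp add: nn_integral_pareto powr_def)
  have tail1: "(\<integral>\<^sup>+y. ennreal (pareto q 1 y) \<partial>lborel) = ennreal (1 / q)"
    using tail[of 0] by simp
  have AB: "1 < A" "A < B"
    using T_ge_2[of n] strict_monoD[OF T_strict_mono, of n "Suc n"] by (auto simp: A_def B_def)
  have a: "0 \<le> ?a" using a_seq_bounds[of n] by simp
  have J_eq: "J = (\<integral>\<^sup>+y. ennreal (w y * pareto q 1 y) \<partial>lborel)"
    unfolding J_def by (rule nn_integral_mu_pareto) simp
  have w_eq: "w y = ?a" if "A \<le> y" "y < B" for y
    using that w_eq_a_seq by (simp add: A_def B_def)
  have "J \<le> ennreal (2 / q)" unfolding J_def by (rule nn_integral_mu_pareto_le) fact
  then obtain j where j: "J = ennreal j" "0 \<le> j"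
    by (metis ennreal_cases ennreal_less_top leD)
  have ab: "0 < \<alpha>" "0 < \<beta>" by (auto simp: \<alpha>_def \<beta>_def)

  have "ennreal ?a * ennreal (\<alpha> / q)
      = (\<integral>\<^sup>+y. ennreal ?a * ennreal (pareto q A y) \<partial>lborel)"
    by (simp add: nn_integral_cmult A_def tail \<alpha>_def)
  also have "\<dots> \<le> (\<integral>\<^sup>+y. ennreal (w y * pareto q 1 y) + ennreal (pareto q B y) \<partial>lborel)"
  proof (intro nn_integral_mono)
    fix y
    \<comment> \<open>On \<open>[A, B)\<close> the weight is \<open>?a\<close>; beyond \<open>B\<close> the right side is at least \<open>2\<close>.\<close>
    have "?a * indicator {A..} y \<le> w y * indicator {1..} y + indicator {B..} y"
      using AB w_eq[of y] w_bounds(1)[of y] a_seq_bounds(2)[of n]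
      by (auto simp: indicator_def)
    from mult_right_mono[OF this, of "y powr (-1 - q)"]
    have "?a * pareto q A y \<le> w y * pareto q 1 y + pareto q B y"
      by (simp add: pareto_def algebra_simps)
    then show "ennreal ?a * ennreal (pareto q A y)
        \<le> ennreal (w y * pareto q 1 y) + ennreal (pareto q B y)"
      using a by (simp flip: ennreal_mult ennreal_plus)
  qed
  also have "\<dots> = J + ennreal (\<beta> / q)"
    by (subst nn_integral_add) (auto simp: J_eq B_def tail \<beta>_def)
  finally have "?a * (\<alpha> / q) \<le> j + \<beta> / q"
    using a assms(1) j(2) ab unfolding j by (simp flip: ennreal_mult ennreal_plus)
  then have "?a * \<alpha> - \<beta> \<le> q * j" using assms(1) by (simp add: field_simps)
  then show "ennreal (?a * \<alpha> - \<beta>) \<le> ennreal q * J"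
    using assms(1) j by (simp add: ennreal_leI flip: ennreal_mult)

  have "J + ennreal (\<alpha> / q)
      = (\<integral>\<^sup>+y. ennreal (w y * pareto q 1 y) + ennreal (pareto q A y) \<partial>lborel)"
    by (subst nn_integral_add) (auto simp: J_eq A_def tail \<alpha>_def)
  also have "\<dots> \<le> (\<integral>\<^sup>+y. ennreal (?a + 1) * ennreal (pareto q 1 y) + ennreal (pareto q B y) \<partial>lborel)"
  proof (intro nn_integral_mono)
    fix y
    \<comment> \<open>On \<open>[A, B)\<close> this is an equality; before \<open>A\<close> and after \<open>B\<close> the summand \<open>1\<close> absorbs \<open>w y - ?a\<close>.\<close>
    have "w y * indicator {1..} y + indicator {A..} y
        \<le> (?a + 1) * indicator {1..} y + indicator {B..} y"
      using AB w_eq[of y] w_bounds(2)[of y] a_seq_bounds(1)[of n]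
      by (auto simp: indicator_def)
    from mult_right_mono[OF this, of "y powr (-1 - q)"]
    have "w y * pareto q 1 y + pareto q A y \<le> (?a + 1) * pareto q 1 y + pareto q B y"
      by (simp add: pareto_def algebra_simps)
    then show "ennreal (w y * pareto q 1 y) + ennreal (pareto q A y)
        \<le> ennreal (?a + 1) * ennreal (pareto q 1 y) + ennreal (pareto q B y)"
      using a by (simp flip: ennreal_mult ennreal_plus)
  qed
  also have "\<dots> = ennreal (?a + 1) * ennreal (1 / q) + ennreal (\<beta> / q)"
    by (subst nn_integral_add) (auto simp: nn_integral_cmult tail1 B_def tail \<beta>_def)
  finally have "j + \<alpha> / q \<le> (?a + 1) / q + \<beta> / q"
    using a assms(1) j(2) ab unfolding j by (simp flip: ennreal_mult ennreal_plus)
  then have "j \<le> (?a + 1 - \<alpha> + \<beta>) / q"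
    by (simp add: add_divide_distrib diff_divide_distrib)
  then have "q * j \<le> ?a + 1 - \<alpha> + \<beta>"
    using assms(1) by (simp add: pos_le_divide_eq mult.commute)
  then show "ennreal q * J \<le> ennreal (?a + 1 - \<alpha> + \<beta>)"
    using assms(1) j by (simp add: ennreal_leI flip: ennreal_mult)
qed

section \<open>Two-sided bounds for the energy\<close>

lemma nn_integral_powr_from_0:
  assumes "-1 < (e::real)" "0 \<le> c"
  shows "(\<integral>\<^sup>+z. ennreal (indicator {0..c} z * z powr e) \<partial>lborel)
    = ennreal (c powr (e + 1) / (e + 1))"
proof -
  have "(\<integral>\<^sup>+z. ennreal (indicator {0..c} z * z powr e) \<partial>lborel)
      = (\<integral>\<^sup>+z. ennreal (z powr e) * indicator {0..c} z \<partial>lborel)"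
    by (intro nn_integral_cong) (simp add: indicator_def)
  also have "\<dots> = ennreal (c powr (e + 1) / (e + 1))"
    using has_integral_powr_from_0[OF assms]
    by (intro nn_integral_has_integral_lebesgue') auto
  finally show ?thesis .
qed


lemma borel_measurable_u [measurable]: "u \<in> borel_measurable borel"
  unfolding u_def[abs_def] by measurable

lemma u_nonneg [simp]: "0 \<le> u x"
  by (simp add: u_def)

text \<open>On the half-line \<^const>\<open>u\<close> is supported in \<open>[0, 1]\<close>, where the weight is \<open>1\<close>; reflection about
  the midpoint of that interval turns the integrand into a power of the variable.\<close>

lemma nn_integral_mu_u_powr:
  assumes "1 \<le> p"
  shows "(\<integral>\<^sup>+x. ennreal (u x powr p) \<partial>\<mu>) = ennreal (1 / (p + 1))"
proof -
  have "(\<integral>\<^sup>+x. ennreal (u x powr p) \<partial>\<mu>)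
      = (\<integral>\<^sup>+x. ennreal (indicator {0..1} (1 + (-1) * x) * (1 + (-1) * x) powr p) \<partial>lborel)"
    using assms
    by (subst nn_integral_mu)
       (auto intro!: nn_integral_cong simp: indicator_def u_def w_def max_def)
  also have "\<dots> = (\<integral>\<^sup>+z. ennreal (indicator {0..1} z * z powr p) \<partial>lborel)"
    by (subst (2) nn_integral_real_affine[where c = "-1" and t = 1]) auto
  also have "\<dots> = ennreal (1 / (p + 1))"
    using assms by (subst nn_integral_powr_from_0) auto
  finally show ?thesis .
qed

text \<open>The integrand of the energy in the two real variables. On the diagonal it is \<open>0 / 0 = 0\<close>, so the
  restriction to \<open>x \<noteq> y\<close> may be dropped.\<close>

definition energy_density :: "real \<Rightarrow> real \<Rightarrow> real \<Rightarrow> real \<Rightarrow> real" where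
  "energy_density p s x y = \<bar>u x - u y\<bar> powr p / \<bar>x - y\<bar> powr (1 + s * p)"

lemma energy_density_commute: "energy_density p s x y = energy_density p s y x"
  by (simp add: energy_density_def abs_minus_commute)

lemma energy_eq:
  "energy \<mu> p s u = ennreal s * (\<integral>\<^sup>+z. ennreal (energy_density p s (fst z) (snd z)) \<partial>(\<mu> \<Otimes>\<^sub>M \<mu>))"
  unfolding energy_def
  by (intro arg_cong2[where f = "(*)"] refl nn_integral_cong)
     (auto simp: energy_density_def dist_real_def indicator_def split: prod.splits)

lemma nn_integral_mu_symmetric_product:
  assumes [measurable]: "f \<in> borel_measurable borel" "g \<in> borel_measurable borel"
    and nonneg: "\<And>x. 0 \<le> f x" "\<And>x. 0 \<le> (g x :: real)"
  shows "(\<integral>\<^sup>+z. ennreal (f (fst z) * g (snd z) + f (snd z) * g (fst z)) \<partial>(\<mu> \<Otimes>\<^sub>M \<mu>))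
    = 2 * ((\<integral>\<^sup>+x. ennreal (f x) \<partial>\<mu>) * (\<integral>\<^sup>+y. ennreal (g y) \<partial>\<mu>))"
proof -
  let ?f = "\<lambda>x. ennreal (f x)" and ?g = "\<lambda>x. ennreal (g x)"
  have "(\<integral>\<^sup>+z. ennreal (f (fst z) * g (snd z) + f (snd z) * g (fst z)) \<partial>(\<mu> \<Otimes>\<^sub>M \<mu>))
      = (\<integral>\<^sup>+z. ?f (fst z) * ?g (snd z) + ?g (fst z) * ?f (snd z) \<partial>(\<mu> \<Otimes>\<^sub>M \<mu>))"
    using nonneg by (intro nn_integral_cong) (simp add: ennreal_mult ennreal_plus mult.commute)
  also have "\<dots> = (\<integral>\<^sup>+z. ?f (fst z) * ?g (snd z) \<partial>(\<mu> \<Otimes>\<^sub>M \<mu>))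
      + (\<integral>\<^sup>+z. ?g (fst z) * ?f (snd z) \<partial>(\<mu> \<Otimes>\<^sub>M \<mu>))"
    by (rule nn_integral_add) measurable
  also have "\<dots> = 2 * ((\<integral>\<^sup>+x. ?f x \<partial>\<mu>) * (\<integral>\<^sup>+y. ?g y \<partial>\<mu>))"
    using nn_integral_product_mu[of ?f ?g] nn_integral_product_mu[of ?g ?f]
    by (simp add: mult.commute mult_2)
  finally show ?thesis .
qed

text \<open>If \<open>x < 1 \<le> y\<close>, then \<open>u y = 0\<close> and \<open>y - x \<le> y\<close>. At most one of the two summands is nonzero, and
  the other pairs of points contribute nothing to the left side.\<close>

lemma energy_density_lower:
  assumes "0 < s" "1 \<le> p" "0 \<le> x" "0 \<le> y"
  shows "u x powr p * pareto (s * p) 1 y + u y powr p * pareto (s * p) 1 x \<le> energy_density p s x y"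
proof -
  have half: "u x powr p * pareto (s * p) 1 y + u y powr p * pareto (s * p) 1 x \<le> energy_density p s x y"
    if "x \<le> y" "0 \<le> x" for x y
  proof (cases "x < 1 \<and> 1 \<le> y")
    case True
    have "u x powr p * y powr (-1 - s * p) = \<bar>u x - u y\<bar> powr p / y powr (1 + s * p)"
      using True by (simp add: u_def powr_neg_one_minus)
    also have "\<dots> \<le> energy_density p s x y"
      unfolding energy_density_def using True that assms
      by (intro divide_left_mono powr_mono2) (auto intro: mult_pos_pos)
    finally show ?thesis using True by (simp add: pareto_def u_def)
  next
    case False
    then show ?thesis using that by (auto simp: pareto_def u_def energy_density_def)
  qed
  show ?thesis
  proof (cases "x \<le> y")
    case False
    with half[of y x] assms show ?thesis by (simp add: energy_density_commute add.commute)
  qed (use half assms in auto)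
qed

lemma energy_lower:
  assumes "0 < s" "1 \<le> p"
  shows "ennreal (2 / (p + 1)) * (ennreal s * (\<integral>\<^sup>+y. ennreal (pareto (s * p) 1 y) \<partial>\<mu>)) \<le> energy \<mu> p s u"
proof -
  let ?J = "\<integral>\<^sup>+y. ennreal (pareto (s * p) 1 y) \<partial>\<mu>"
  have "ennreal (2 / (p + 1)) = 2 * ennreal (1 / (p + 1))"
    using assms by (simp flip: ennreal_mult ennreal_numeral)
  then have "ennreal (2 / (p + 1)) * (ennreal s * ?J) = ennreal s * (2 * (ennreal (1 / (p + 1)) * ?J))"
    by (simp add: ac_simps)
  also have "2 * (ennreal (1 / (p + 1)) * ?J)
    = (\<integral>\<^sup>+z. ennreal (u (fst z) powr p * pareto (s * p) 1 (snd z)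
        + u (snd z) powr p * pareto (s * p) 1 (fst z)) \<partial>(\<mu> \<Otimes>\<^sub>M \<mu>))"
    using assms by (subst nn_integral_mu_symmetric_product) (auto simp: nn_integral_mu_u_powr)
  also have "\<dots> \<le> (\<integral>\<^sup>+z. ennreal (energy_density p s (fst z) (snd z)) \<partial>(\<mu> \<Otimes>\<^sub>M \<mu>))"
    using assms
    by (intro nn_integral_mono ennreal_leI energy_density_lower)
       (auto simp: space_pair_measure space_mu)
  finally show ?thesis by (simp add: energy_eq mult_left_mono)
qed

text \<open>For \<open>x \<le> 1\<close> and \<open>y > 2\<close> the distance \<open>y - x\<close> is at least \<open>y - 1\<close>, which leads to this kernel in the upper
  bound. Cutting at \<open>2\<close> instead of \<open>1\<close> keeps it away from its singularity at \<open>1\<close>.\<close>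

definition shifted_pareto :: "real \<Rightarrow> real \<Rightarrow> real" where
  "shifted_pareto q y = indicator {2<..} y * (y - 1) powr (-1 - q)"

lemma borel_measurable_shifted_pareto [measurable]: "shifted_pareto q \<in> borel_measurable borel"
  unfolding shifted_pareto_def[abs_def] by measurable

lemma shifted_pareto_nonneg [simp]: "0 \<le> shifted_pareto q y"
  by (simp add: shifted_pareto_def)

text \<open>The shift costs the factor \<open>(y / (y - 1)) powr (1 + q)\<close>, at most \<open>1 + 6 / y\<close> for \<open>y \<ge> 2\<close> and \<open>q \<le> 1\<close>. The extra
  term decays like \<open>1 / y\<^sup>2\<close>, hence its integral stays bounded as \<open>q\<close> tends to \<open>0\<close> and the prefactor
  \<open>s\<close> of the energy kills it.\<close>

lemma shifted_pareto_le:
  assumes "0 < q" "q \<le> 1"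
  shows "shifted_pareto q y \<le> pareto q 1 y + 6 * pareto 1 1 y"
proof (cases "2 < y")
  case True
  have "(y / (y - 1)) powr (1 + q) \<le> (y / (y - 1)) powr 2"
    using True assms by (intro powr_mono) auto
  also have "\<dots> = (y / (y - 1))\<^sup>2" using True by simp
  also have "\<dots> \<le> 1 + 6 / y"
  proof -
    have "y ^ 3 \<le> (y + 6) * (y - 1)\<^sup>2"
    proof -
      \<comment> \<open>\<open>(y + 6) * (y - 1)\<^sup>2 - y ^ 3 = (y - 2) * (4 * y - 3)\<close>\<close>
      have "0 \<le> (y - 2) * (4 * y - 3)" using True by simp
      then show ?thesis by (simp add: power2_eq_square power3_eq_cube algebra_simps)
    qed
    then show ?thesis using True by (simp add: field_simps power2_eq_square power3_eq_cube)
  qed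
  finally have *: "(y / (y - 1)) powr (1 + q) \<le> 1 + 6 / y" .
  have "(y - 1) powr (-1 - q) = (y / (y - 1)) powr (1 + q) * y powr (-1 - q)"
    using True by (simp add: powr_divide powr_neg_one_minus)
  also have "\<dots> \<le> (1 + 6 / y) * y powr (-1 - q)"
    using * by (intro mult_right_mono) auto
  also have "\<dots> = y powr (-1 - q) + 6 * y powr (-2 - q)"
    using True powr_add[of y "-1" "-1 - q"] by (simp add: algebra_simps powr_minus_divide)
  also have "\<dots> \<le> y powr (-1 - q) + 6 * y powr (-2)"
    using True assms by (intro add_left_mono mult_left_mono powr_mono) auto
  finally show ?thesis using True by (simp add: shifted_pareto_def pareto_def)
qed (simp add: shifted_pareto_def)

lemma nn_integral_mu_shifted_pareto_le:
  assumes "0 < q" "q \<le> 1"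
  shows "(\<integral>\<^sup>+y. ennreal (shifted_pareto q y) \<partial>\<mu>) \<le> (\<integral>\<^sup>+y. ennreal (pareto q 1 y) \<partial>\<mu>) + 12"
proof -
  have "(\<integral>\<^sup>+y. ennreal (shifted_pareto q y) \<partial>\<mu>)
      \<le> (\<integral>\<^sup>+y. ennreal (pareto q 1 y) + ennreal 6 * ennreal (pareto 1 1 y) \<partial>\<mu>)"
    by (intro nn_integral_mono, rule order.trans[OF ennreal_leI[OF shifted_pareto_le[OF assms]]])
       (simp add: ennreal_mult)
  also have "\<dots> = (\<integral>\<^sup>+y. ennreal (pareto q 1 y) \<partial>\<mu>) + ennreal 6 * (\<integral>\<^sup>+y. ennreal (pareto 1 1 y) \<partial>\<mu>)"
    by (subst nn_integral_add) (auto simp: nn_integral_cmult)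
  also have "ennreal 6 * (\<integral>\<^sup>+y. ennreal (pareto 1 1 y) \<partial>\<mu>) \<le> ennreal 6 * ennreal 2"
    using nn_integral_mu_pareto_le[of 1] by (intro mult_left_mono) auto
  also have "ennreal 6 * ennreal 2 = 12" by (simp flip: ennreal_mult)
  finally show ?thesis by (simp add: add_left_mono)
qed

text \<open>A majorant, independent of \<open>s\<close> and \<open>p\<close>, for the energy density on the square \<open>[0, 2]\<^sup>2\<close>.
  The exponent \<open>- 1/2\<close> is still integrable across the diagonal.\<close>

definition local_kernel :: "real \<Rightarrow> real \<Rightarrow> real" where
  "local_kernel x y = indicator {0..2} x * indicator {0..2} y * \<bar>x - y\<bar> powr (- (1/2))"

lemma local_kernel_nonneg [simp]: "0 \<le> local_kernel x y"
  by (simp add: local_kernel_def)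

text \<open>On \<open>[0, 2]\<^sup>2\<close> the function \<^const>\<open>u\<close> is 1-Lipschitz with values in \<open>[0, 1]\<close>, so with \<open>d = \<bar>x - y\<bar>\<close> the density is at
  most \<open>d powr (p - 1 - s * p)\<close> for \<open>d \<le> 1\<close> and at most \<open>d powr (- 1 - s * p)\<close> for \<open>d > 1\<close>; either is at
  most \<open>d powr (- 1/2)\<close> because \<open>p * (1 - s) \<ge> 1/2\<close> and \<open>s * p \<ge> 0\<close>. Off this square the density vanishes unless one point is
  below \<open>1\<close> and the other beyond \<open>2\<close>.\<close>

lemma energy_density_upper:
  assumes "0 < s" "1 \<le> p" "s \<le> 1/2" "0 \<le> x" "0 \<le> y"
  shows "energy_density p s x y \<le> local_kernel x y
    + (u x powr p * shifted_pareto (s * p) y + u y powr p * shifted_pareto (s * p) x)"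
proof -
  have half: "energy_density p s x y \<le> local_kernel x y
      + (u x powr p * shifted_pareto (s * p) y + u y powr p * shifted_pareto (s * p) x)"
    if "x \<le> y" "0 \<le> x" for x y
  proof (cases "x = y")
    case True then show ?thesis
      by (simp add: energy_density_def local_kernel_def add_nonneg_nonneg)
  next
    case False
    with that have lt: "x < y" by simp
    let ?d = "y - x"
    show ?thesis
    proof (cases "y \<le> 2")
      case True
      have "\<bar>u x - u y\<bar> powr p \<le> (min ?d 1) powr p"
        using that True assms by (intro powr_mono2) (auto simp: u_def)
      moreover have "(min ?d 1) powr p / ?d powr (1 + s * p) \<le> ?d powr (- (1/2))"
      proof (cases "?d \<le> 1")
        case True
        have "s * p \<le> 1/2 * p" using assms by (intro mult_right_mono) auto
        then have "- (1/2) \<le> p - (1 + s * p)" using assms(2) by linarith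
        then have "?d powr (p - (1 + s * p)) \<le> ?d powr (- (1/2))"
          using True lt by (intro powr_mono') auto
        then show ?thesis using True by (simp add: powr_diff)
      next
        case False
        have "0 \<le> s * p" using assms by simp
        then have "?d powr (- (1 + s * p)) \<le> ?d powr (- (1/2))"
          using False by (intro powr_mono) linarith+
        then show ?thesis using False by (simp add: powr_minus_divide powr_neg_one_minus)
      qed
      ultimately have "energy_density p s x y \<le> ?d powr (- (1/2))"
        unfolding energy_density_def using lt
        by (simp add: abs_minus_commute) (meson divide_right_mono order.trans powr_ge_zero)
      then show ?thesis
        using True that by (simp add: local_kernel_def add_increasing2 abs_minus_commute)
    next
      case False
      show ?thesis
      proof (cases "x < 1")
        case True
        have "energy_density p s x y = u x powr p / ?d powr (1 + s * p)"
          using False True lt by (simp add: energy_density_def u_def)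
        also have "\<dots> \<le> u x powr p / (y - 1) powr (1 + s * p)"
          using False True that assms
          by (intro divide_left_mono powr_mono2) (auto intro: mult_pos_pos)
        also have "\<dots> = u x powr p * shifted_pareto (s * p) y"
          using False by (simp add: shifted_pareto_def powr_neg_one_minus)
        finally show ?thesis by (simp add: local_kernel_def add_increasing add_increasing2)
      next
        case x: False
        then show ?thesis using False 
          by (simp add: energy_density_def u_def local_kernel_def)
      qed
    qed
  qed
  show ?thesis
  proof (cases "x \<le> y")
    case False
    with half[of y x] assms show ?thesis
      by (simp add: energy_density_commute local_kernel_def abs_minus_commute ac_simps)
  qed (use half assms in auto)
qed

text \<open>By translation invariance of Lebesgue measure the inner integral is bounded uniformly in \<open>x\<close>, by
  \<open>2 * (3 + 3)\<close>: the weight is at most \<open>2\<close>, and each side of the diagonal contributes at most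
  \<open>2 * sqrt 2 \<le> 3\<close>. The outer integral over \<open>[0, 2]\<close> costs another factor \<open>4\<close>.\<close>

lemma nn_integral_local_kernel:
  "(\<integral>\<^sup>+z. ennreal (local_kernel (fst z) (snd z)) \<partial>(\<mu> \<Otimes>\<^sub>M \<mu>)) \<le> 48"
proof -
  interpret sigma_finite_measure \<mu> by (rule sigma_finite_mu)
  define \<phi> :: "real \<Rightarrow> real" where "\<phi> z = indicator {0..2} z * z powr (- (1/2))" for z
  have [measurable]: "\<phi> \<in> borel_measurable borel" unfolding \<phi>_def[abs_def] by measurable
  have \<phi>0: "0 \<le> \<phi> z" for z by (simp add: \<phi>_def)
  have I: "(\<integral>\<^sup>+z. ennreal (\<phi> z) \<partial>lborel) \<le> ennreal 3"
  proof -
    have "sqrt 2 * 2 \<le> (3::real)" by (rule power2_le_imp_le) (simp_all add: power_mult_distrib)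
    then have "2 powr (- (1/2) + 1) / (- (1/2) + 1) \<le> (3::real)" by (simp add: powr_half_sqrt)
    then show ?thesis
      unfolding \<phi>_def
      by (subst nn_integral_powr_from_0) (auto intro: ennreal_leI simp del: ennreal_numeral)
  qed
  have inner: "(\<integral>\<^sup>+y. ennreal (local_kernel x y) \<partial>\<mu>) \<le> ennreal 12 * indicator {0..2} x" for x
  proof -
    have "(\<integral>\<^sup>+y. ennreal (local_kernel x y) \<partial>\<mu>)
        \<le> (\<integral>\<^sup>+y. ennreal (2 * indicator {0..2} x) * (ennreal (\<phi> (x + (-1) * y)) + ennreal (\<phi> (- x + 1 * y))) \<partial>lborel)"
    proof (subst nn_integral_mu, goal_cases)
      case 2
      have "w y * local_kernel x y * indicator {0..} y \<le> 2 * indicator {0..2} x * (\<phi> (x - y) + \<phi> (y - x))" for y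
      proof -
        have "w y * local_kernel x y \<le> 2 * local_kernel x y"
          by (intro mult_right_mono w_bounds) (simp add: local_kernel_def)
        moreover have "local_kernel x y \<le> indicator {0..2} x * (\<phi> (x - y) + \<phi> (y - x))"
          by (auto simp: local_kernel_def \<phi>_def indicator_def abs_if)
        ultimately show ?thesis using \<phi>0 by (auto simp: indicator_def split: if_splits)
      qed
      then show ?case 
        using \<phi>0 by (intro nn_integral_mono) 
          (auto simp flip: ennreal_mult ennreal_plus ennreal_indicator simp: local_kernel_def intro!: ennreal_leI)
    qed (simp add: local_kernel_def)
    also have "\<dots> = ennreal (2 * indicator {0..2} x) *
        ((\<integral>\<^sup>+y. ennreal (\<phi> (x + (-1) * y)) \<partial>lborel) + (\<integral>\<^sup>+y. ennreal (\<phi> (- x + 1 * y)) \<partial>lborel))"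
      by (subst nn_integral_cmult, measurable, subst nn_integral_add) measurable
    also have "(\<integral>\<^sup>+y. ennreal (\<phi> (x + (-1) * y)) \<partial>lborel) = (\<integral>\<^sup>+z. ennreal (\<phi> z) \<partial>lborel)"
      by (subst (2) nn_integral_real_affine[where c = "-1" and t = x]) auto
    also have "(\<integral>\<^sup>+y. ennreal (\<phi> (- x + 1 * y)) \<partial>lborel) = (\<integral>\<^sup>+z. ennreal (\<phi> z) \<partial>lborel)"
      by (subst (2) nn_integral_real_affine[where c = 1 and t = "- x"]) auto
    also have "ennreal (2 * indicator {0..2} x) * ((\<integral>\<^sup>+z. ennreal (\<phi> z) \<partial>lborel) + (\<integral>\<^sup>+z. ennreal (\<phi> z) \<partial>lborel))
        \<le> ennreal (2 * indicator {0..2} x) * (ennreal 3 + ennreal 3)"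
      by (intro mult_left_mono add_mono I) auto
    also have "\<dots> = ennreal 12 * indicator {0..2} x"
      by (simp add: indicator_def flip: ennreal_plus ennreal_mult)
    finally show ?thesis .
  qed
  have "(\<integral>\<^sup>+z. ennreal (local_kernel (fst z) (snd z)) \<partial>(\<mu> \<Otimes>\<^sub>M \<mu>))
      = (\<integral>\<^sup>+x. (\<integral>\<^sup>+y. ennreal (local_kernel x y) \<partial>\<mu>) \<partial>\<mu>)"
    by (subst nn_integral_fst[symmetric]) (auto simp: local_kernel_def)
  also have "\<dots> \<le> (\<integral>\<^sup>+x. ennreal 12 * indicator {0..2} x \<partial>\<mu>)"
    by (intro nn_integral_mono inner)
  also have "\<dots> \<le> (\<integral>\<^sup>+x. ennreal 24 * indicator {0..2::real} x \<partial>lborel)"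
  proof (subst nn_integral_mu, goal_cases)
    case 2
    have "ennreal (w x) * ennreal 12 \<le> ennreal 24" for x
      using w_bounds(2)[of x] by (subst ennreal_mult[symmetric]) (auto intro!: ennreal_leI simp del: ennreal_numeral)
    then show ?case by (intro nn_integral_mono) (auto simp: indicator_def)
  qed simp
  also have "\<dots> = 48"
    by (subst nn_integral_cmult_indicator) (auto simp flip: ennreal_mult ennreal_numeral)
  finally show ?thesis .
qed

text \<open>The error consists of \<open>48\<close> from the square \<open>[0, 2]\<^sup>2\<close> and of \<open>2 / (p + 1) * 12 \<le> 12\<close> from the
  shift of the kernel.\<close>

lemma energy_upper:
  assumes "0 < s" "1 \<le> p" "s * p \<le> 1 / 2"
  shows "energy \<mu> p s u
    \<le> ennreal (2 / (p + 1)) * (ennreal s * (\<integral>\<^sup>+y. ennreal (pareto (s * p) 1 y) \<partial>\<mu>)) + ennreal (60 * s)"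
proof -
  let ?J = "\<integral>\<^sup>+y. ennreal (pareto (s * p) 1 y) \<partial>\<mu>"
  let ?K = "\<integral>\<^sup>+y. ennreal (shifted_pareto (s * p) y) \<partial>\<mu>"
  have s: "s \<le> 1 / 2" using assms mult_left_mono[of 1 p s] by linarith
  have "(\<integral>\<^sup>+z. ennreal (energy_density p s (fst z) (snd z)) \<partial>(\<mu> \<Otimes>\<^sub>M \<mu>))
    \<le> (\<integral>\<^sup>+z. ennreal (local_kernel (fst z) (snd z))
        + ennreal (u (fst z) powr p * shifted_pareto (s * p) (snd z)
                 + u (snd z) powr p * shifted_pareto (s * p) (fst z)) \<partial>(\<mu> \<Otimes>\<^sub>M \<mu>))"
  proof (rule nn_integral_mono)
    fix z assume "z \<in> space (\<mu> \<Otimes>\<^sub>M \<mu>)"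
    then have "0 \<le> fst z" "0 \<le> snd z" by (auto simp: space_pair_measure space_mu)
    from ennreal_leI[OF energy_density_upper[OF assms(1,2) s this]]
    show "ennreal (energy_density p s (fst z) (snd z)) \<le> ennreal (local_kernel (fst z) (snd z))
        + ennreal (u (fst z) powr p * shifted_pareto (s * p) (snd z)
                 + u (snd z) powr p * shifted_pareto (s * p) (fst z))"
      by simp
  qed
  also have "\<dots> = (\<integral>\<^sup>+z. ennreal (local_kernel (fst z) (snd z)) \<partial>(\<mu> \<Otimes>\<^sub>M \<mu>))
      + 2 * (ennreal (1 / (p + 1)) * ?K)"
    using assms
    by (subst nn_integral_add, simp add: local_kernel_def, measurable,
        subst nn_integral_mu_symmetric_product) (auto simp: nn_integral_mu_u_powr)
  also have "\<dots> \<le> 48 + 2 * (ennreal (1 / (p + 1)) * (?J + 12))"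
    using assms by (intro add_mono mult_left_mono nn_integral_local_kernel nn_integral_mu_shifted_pareto_le) auto
  also have "\<dots> = ennreal (2 / (p + 1)) * ?J + (ennreal 48 + ennreal (2 / (p + 1)) * ennreal 12)"
  proof -
    have "2 * ennreal (1 / (p + 1)) = ennreal (2 / (p + 1))"
      using assms by (simp flip: ennreal_mult ennreal_numeral)
    moreover have "2 * (ennreal (1 / (p + 1)) * (?J + 12))
        = (2 * ennreal (1 / (p + 1))) * ?J + (2 * ennreal (1 / (p + 1))) * 12"
      by (simp only: distrib_left mult.assoc)
    ultimately show ?thesis by (simp add: ac_simps)
  qed
  also have "\<dots> \<le> ennreal (2 / (p + 1)) * ?J + ennreal 60"
  proof (rule add_left_mono)
    have "ennreal (2 / (p + 1)) \<le> ennreal 1" using assms by (intro ennreal_leI) simp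
    then have "ennreal 48 + ennreal (2 / (p + 1)) * ennreal 12 \<le> ennreal 48 + ennreal 1 * ennreal 12"
      by (intro add_left_mono mult_right_mono) simp_all
    then show "ennreal 48 + ennreal (2 / (p + 1)) * ennreal 12 \<le> ennreal 60" by simp
  qed
  finally have "energy \<mu> p s u \<le> ennreal s * (ennreal (2 / (p + 1)) * ?J + ennreal 60)"
    unfolding energy_eq by (rule mult_left_mono) simp
  also have "\<dots> = ennreal (2 / (p + 1)) * (ennreal s * ?J) + ennreal (60 * s)"
    using assms by (simp add: distrib_left ac_simps ennreal_mult')
  finally show ?thesis .
qed

section \<open>Volumes of balls\<close>

lemma emeasure_mu_Icc:
  assumes "0 \<le> l"
  shows "emeasure \<mu> {l..b} = (\<integral>\<^sup>+x. ennreal (w x) * indicator {l..b} x \<partial>lborel)"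
proof -
  have "{l..b} \<in> sets \<mu>"
    using assms by (auto simp: sets_mu sets_restrict_space_iff)
  then have "emeasure \<mu> {l..b} = (\<integral>\<^sup>+x. indicator {l..b} x \<partial>\<mu>)" by simp
  also have "\<dots> = (\<integral>\<^sup>+x. ennreal (w x) * indicator {l..b} x \<partial>lborel)"
    using assms by (subst nn_integral_mu) (auto intro!: nn_integral_cong simp: indicator_def)
  finally show ?thesis .
qed

lemma emeasure_mu_Icc_bounds:
  assumes "0 \<le> l" "l \<le> b"
  shows "ennreal (b - l) \<le> emeasure \<mu> {l..b}" "emeasure \<mu> {l..b} \<le> ennreal (2 * (b - l))"
proof -
  have "ennreal (b - l) = (\<integral>\<^sup>+x. 1 * indicator {l..b} x \<partial>lborel)" using assms by simp
  also have "\<dots> \<le> emeasure \<mu> {l..b}"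
    unfolding emeasure_mu_Icc[OF assms(1)]
    by (intro nn_integral_mono mult_right_mono) (auto simp: w_bounds)
  finally show "ennreal (b - l) \<le> emeasure \<mu> {l..b}" .
  have "emeasure \<mu> {l..b} \<le> (\<integral>\<^sup>+x. ennreal 2 * indicator {l..b} x \<partial>lborel)"
    unfolding emeasure_mu_Icc[OF assms(1)]
    by (intro nn_integral_mono mult_right_mono ennreal_leI w_bounds) auto
  also have "\<dots> = ennreal 2 * ennreal (b - l)"
    using assms by (subst nn_integral_cmult_indicator) auto
  also have "\<dots> = ennreal (2 * (b - l))"
    using assms by (subst ennreal_mult) auto
  finally show "emeasure \<mu> {l..b} \<le> ennreal (2 * (b - l))" .
qed

lemma emeasure_mu_Icc_eq_measure:
  assumes "0 \<le> l" "l \<le> b"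
  shows "emeasure \<mu> {l..b} = ennreal (measure \<mu> {l..b})"
  using emeasure_mu_Icc_bounds(2)[OF assms]
  by (intro emeasure_eq_ennreal_measure) (auto simp: top_unique)

lemma measure_mu_Icc_bounds:
  assumes "0 \<le> l" "l \<le> b"
  shows "b - l \<le> measure \<mu> {l..b}" "measure \<mu> {l..b} \<le> 2 * (b - l)"
  using emeasure_mu_Icc_bounds[OF assms] assms
  unfolding emeasure_mu_Icc_eq_measure[OF assms] by simp_all

text \<open>To the right of \<open>exp (T n)\<close> the weight on the interval is exactly \<open>a_seq n\<close>, and to the left of
  it differs from that value by at most \<open>1\<close>. Past stages of the weight thus cost at most
  \<open>exp (T n)\<close>, however long the interval is.\<close>

lemma measure_mu_Icc_near:
  assumes "0 \<le> l" "l \<le> b" "b < exp (T (Suc n))"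
  shows "\<bar>measure \<mu> {l..b} - a_seq n * (b - l)\<bar> \<le> exp (T n)"
proof -
  define A where "A = exp (T n)"
  have A: "0 \<le> A" by (simp add: A_def)
  have a: "0 \<le> a_seq n" using a_seq_bounds[of n] by simp
  have w_eq: "w x = a_seq n" if "x \<le> b" "A \<le> x" for x
    using that assms w_eq_a_seq[of n x] by (simp add: A_def)
  have I: "(\<integral>\<^sup>+x. indicator {0..A} x \<partial>lborel) = ennreal A" using A by simp
  have J: "(\<integral>\<^sup>+x. ennreal (a_seq n) * indicator {l..b} x \<partial>lborel) = ennreal (a_seq n * (b - l))"
    using assms a by (subst nn_integral_cmult_indicator) (auto simp: ennreal_mult)
  have "emeasure \<mu> {l..b} \<le> (\<integral>\<^sup>+x. ennreal (a_seq n) * indicator {l..b} x + indicator {0..A} x \<partial>lborel)"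
    unfolding emeasure_mu_Icc[OF assms(1)]
  proof (intro nn_integral_mono)
    fix x
    have "w x * indicator {l..b} x \<le> a_seq n * indicator {l..b} x + indicator {0..A} x"
      using assms(1) w_eq[of x] w_bounds[of x] a_seq_bounds[of n] by (auto simp: indicator_def)
    from ennreal_leI[OF this]
    show "ennreal (w x) * indicator {l..b} x \<le> ennreal (a_seq n) * indicator {l..b} x + indicator {0..A} x"
      using a by (simp add: ennreal_mult flip: ennreal_indicator)
  qed
  also have "\<dots> = ennreal (a_seq n * (b - l) + A)"
    using assms a A by (subst nn_integral_add) (auto simp: I J)
  finally have 1: "measure \<mu> {l..b} \<le> a_seq n * (b - l) + A"
    using assms a A unfolding emeasure_mu_Icc_eq_measure[OF assms(1,2)]
    by (subst (asm) ennreal_le_iff) auto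
  have "ennreal (a_seq n * (b - l)) = (\<integral>\<^sup>+x. ennreal (a_seq n) * indicator {l..b} x \<partial>lborel)"
    by (simp add: J)
  also have "\<dots> \<le> (\<integral>\<^sup>+x. ennreal (w x) * indicator {l..b} x + indicator {0..A} x \<partial>lborel)"
  proof (intro nn_integral_mono)
    fix x
    have "a_seq n * indicator {l..b} x \<le> w x * indicator {l..b} x + indicator {0..A} x"
      using assms(1) w_eq[of x] w_bounds[of x] a_seq_bounds[of n] by (auto simp: indicator_def)
    from ennreal_leI[OF this]
    show "ennreal (a_seq n) * indicator {l..b} x \<le> ennreal (w x) * indicator {l..b} x + indicator {0..A} x"
      using a by (simp add: ennreal_mult flip: ennreal_indicator)
  qed
  also have "\<dots> = ennreal (measure \<mu> {l..b} + A)"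
    using A by (subst nn_integral_add)
      (auto simp: I emeasure_mu_Icc[OF assms(1), symmetric] emeasure_mu_Icc_eq_measure[OF assms(1,2)])
  finally have 2: "a_seq n * (b - l) \<le> measure \<mu> {l..b} + A"
    using A by (subst (asm) ennreal_le_iff) auto
  from 1 2 show ?thesis by (simp add: A_def abs_le_iff)
qed

lemma mball_of_mu:
  assumes "0 \<le> x"
  shows "mball_of \<mu> x r = {max 0 (x - r)..x + r}"
  using assms by (auto simp: mball_of_def space_mu dist_real_def)

text \<open>A closed ball of radius \<open>r\<close> in the half-line is an interval of length between \<open>r\<close> and \<open>2 * r\<close>.\<close>

lemma ahlfors_regular_mu: "ahlfors_regular 1 \<mu>"
  unfolding ahlfors_regular_def
proof (rule conjI, goal_cases)
  case 1
  show "metric_measure_space \<mu>"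
    by (simp add: metric_measure_space_def sets_mu space_mu)
next
  case 2
  show ?case
  proof (rule exI[of _ 1], rule exI[of _ 4], intro conjI ballI allI impI)
  fix x r :: real assume x: "x \<in> space \<mu>" and r: "0 < r"
  then have x0: "0 \<le> x" by (simp add: space_mu)
  let ?l = "max 0 (x - r)"
  have *: "0 \<le> ?l" "?l \<le> x + r" using x0 r by auto
  have "ennreal (1 * r powr 1) \<le> ennreal (x + r - ?l)" using x0 r by (intro ennreal_leI) auto
  also note emeasure_mu_Icc_bounds(1)[OF *]
  finally show "ennreal (1 * r powr 1) \<le> emeasure \<mu> (mball_of \<mu> x r)"
    by (simp only: mball_of_mu[OF x0])
  note emeasure_mu_Icc_bounds(2)[OF *]
  also have "ennreal (2 * (x + r - ?l)) \<le> ennreal (4 * r powr 1)"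
    using x0 r by (intro ennreal_leI) (auto simp: max_def)
  finally show "emeasure \<mu> (mball_of \<mu> x r) \<le> ennreal (4 * r powr 1)"
    by (simp only: mball_of_mu[OF x0])
  qed auto
qed

section \<open>Energies between consecutive switches of the weight\<close>

text \<open>This scale lies strictly between \<open>T (Suc m)\<close> and \<open>T (Suc (Suc m))\<close> on the logarithmic axis, and as
  \<open>T (Suc m) = (T m)\<^sup>2\<close> it is a factor \<open>T m\<close> away from either end. Seen from here, only the stage of the
  weight with value \<open>a_seq (Suc m)\<close> is visible.\<close>

definition log_scale :: "nat \<Rightarrow> real" where
  "log_scale m = T m * T (Suc m)"

lemma log_scale_ge_4: "4 \<le> log_scale m"
  using mult_mono[OF T_ge_2[of m] T_ge_2[of "Suc m"]] T_ge_2[of m] by (simp add: log_scale_def)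

lemma log_scale_pos: "0 < log_scale m"
  using log_scale_ge_4[of m] by linarith

lemma filterlim_log_scale: "filterlim log_scale at_top sequentially"
  unfolding log_scale_def[abs_def]
  using filterlim_T filterlim_compose[OF filterlim_T filterlim_Suc]
  by (rule filterlim_at_top_mult_at_top)

lemma tendsto_inverse_T: "(\<lambda>m. 1 / T m) \<longlonglongrightarrow> 0"
  by (rule tendsto_divide_0[OF tendsto_const filterlim_at_top_imp_at_infinity[OF filterlim_T]])

lemma tendsto_exp_minus_T: "(\<lambda>m. exp (- T m)) \<longlonglongrightarrow> 0"
  using filterlim_T
  by (intro filterlim_compose[OF exp_at_bot]) (simp add: filterlim_uminus_at_top)

lemma log_scale_ratios:
  "T (Suc m) / log_scale m = 1 / T m" "T (Suc (Suc m)) / log_scale m = T m"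
  using T_ge_2[of m] by (simp_all add: log_scale_def T_Suc power2_eq_square)

text \<open>With \<open>s * p = 1 / log_scale m\<close> the two exponentials in the bounds for the Pareto moment become
  \<open>exp (- 1 / T m)\<close> and \<open>exp (- T m)\<close>, whose limits are \<open>1\<close> and \<open>0\<close>.\<close>

lemma energy_at_log_scale:
  assumes "1 \<le> p"
  defines "s \<equiv> \<lambda>m. 1 / (p * log_scale m)"
    and "K \<equiv> 2 / (p * (p + 1))"
  shows "ennreal (K * (a_seq (Suc m) * exp (- (1 / T m)) - exp (- T m))) \<le> energy \<mu> p (s m) u"
    and "energy \<mu> p (s m) u
      \<le> ennreal (K * (a_seq (Suc m) + 1 - exp (- (1 / T m)) + exp (- T m)) + 60 * s m)"
proof -
  define q where "q = s m * p"
  have q: "q = 1 / log_scale m" using assms(1) by (simp add: q_def s_def)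
  have q0: "0 < q" using log_scale_pos[of m] by (simp add: q)
  have s0: "0 < s m" using q0 assms(1) by (simp add: q_def zero_less_mult_iff)
  have q_le: "q \<le> 1 / 2" using log_scale_ge_4[of m] by (simp add: q field_simps)
  define J where "J = (\<integral>\<^sup>+y. ennreal (pareto q 1 y) \<partial>\<mu>)"
  have exps: "exp (- q * T (Suc m)) = exp (- (1 / T m))" "exp (- q * T (Suc (Suc m))) = exp (- T m)"
    using log_scale_ratios[of m] by (simp_all add: q)
  note J = pareto_moment_bounds[OF q0, of "Suc m", folded J_def, unfolded exps]
  have K0: "0 \<le> K" using assms(1) by (simp add: K_def)
  have KJ: "ennreal (2 / (p + 1)) * (ennreal (s m) * J) = ennreal K * (ennreal q * J)"
  proof -
    have "2 / (p + 1) * s m = K * q" using assms(1) by (simp add: K_def q_def)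
    then show ?thesis using K0 q0 s0 assms(1) by (simp add: mult.assoc[symmetric] flip: ennreal_mult)
  qed
  have "ennreal (K * (a_seq (Suc m) * exp (- (1 / T m)) - exp (- T m)))
      = ennreal K * ennreal (a_seq (Suc m) * exp (- (1 / T m)) - exp (- T m))"
    using K0 by (rule ennreal_mult')
  also have "\<dots> \<le> ennreal K * (ennreal q * J)" by (intro mult_left_mono J) simp
  also have "\<dots> \<le> energy \<mu> p (s m) u"
    using energy_lower[OF s0 assms(1), folded q_def, folded J_def] unfolding KJ .
  finally show "ennreal (K * (a_seq (Suc m) * exp (- (1 / T m)) - exp (- T m))) \<le> energy \<mu> p (s m) u" .
  have "energy \<mu> p (s m) u \<le> ennreal K * (ennreal q * J) + ennreal (60 * s m)"
    using energy_upper[OF s0 assms(1), folded q_def, folded J_def, OF q_le] unfolding KJ .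
  also have "\<dots> \<le> ennreal K * ennreal (a_seq (Suc m) + 1 - exp (- (1 / T m)) + exp (- T m)) + ennreal (60 * s m)"
    by (intro add_right_mono mult_left_mono J) simp
  also have "\<dots> = ennreal (K * (a_seq (Suc m) + 1 - exp (- (1 / T m)) + exp (- T m)) + 60 * s m)"
  proof -
    have "exp (- (1 / T m)) \<le> 1" using T_ge_2[of m] by simp
    then have "0 \<le> a_seq (Suc m) + 1 - exp (- (1 / T m)) + exp (- T m)"
      using a_seq_bounds(1)[of "Suc m"] exp_ge_zero[of "- T m"] by linarith
    then show ?thesis using K0 s0 by (simp add: ennreal_mult)
  qed
  finally show "energy \<mu> p (s m) u
      \<le> ennreal (K * (a_seq (Suc m) + 1 - exp (- (1 / T m)) + exp (- T m)) + 60 * s m)" .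
qed

lemma energy_tendsto_along_log_scale:
  assumes p: "1 \<le> p" and r: "strict_mono r" and a: "\<And>k. a_seq (Suc (r k)) = a"
  defines "s \<equiv> \<lambda>k. 1 / (p * log_scale (r k))"
  shows "(\<forall>k. 0 < s k) \<and> (\<forall>k. s (Suc k) < s k) \<and> s \<longlonglongrightarrow> 0 \<and>
    (\<lambda>k. energy \<mu> p (s k) u) \<longlonglongrightarrow> ennreal (2 * a / (p * (p + 1)))"
proof (intro conjI allI)
  have r_lim: "filterlim r sequentially sequentially" using r by (rule filterlim_subseq)
  show "0 < s k" for k using p log_scale_pos[of "r k"] by (simp add: s_def)
  show "s (Suc k) < s k" for k
  proof -
    have "T (r k) < T (r (Suc k))" "T (Suc (r k)) < T (Suc (r (Suc k)))"
      using strict_monoD[OF r, of k "Suc k"] T_strict_mono by (simp_all add: strict_mono_less)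
    then have "log_scale (r k) < log_scale (r (Suc k))"
      unfolding log_scale_def using T_ge_2[of "r k"] T_ge_2[of "Suc (r k)"]
      by (intro mult_strict_mono) auto
    then show ?thesis using p log_scale_pos[of "r k"] by (simp add: s_def divide_strict_left_mono)
  qed
  show s_lim: "s \<longlonglongrightarrow> 0"
  proof -
    have "(\<lambda>k. 1 / p * (1 / log_scale (r k))) \<longlonglongrightarrow> 1 / p * 0"
      using filterlim_compose[OF filterlim_log_scale r_lim]
      by (intro tendsto_mult tendsto_const tendsto_divide_0[OF tendsto_const] filterlim_at_top_imp_at_infinity)
    then show ?thesis by (simp add: s_def[abs_def])
  qed
  let ?K = "2 / (p * (p + 1))"
  have e1: "(\<lambda>k. exp (- (1 / T (r k)))) \<longlonglongrightarrow> 1"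
    using tendsto_exp[OF tendsto_minus[OF filterlim_compose[OF tendsto_inverse_T r_lim]]] by simp
  have e2: "(\<lambda>k. exp (- T (r k))) \<longlonglongrightarrow> 0"
    by (rule filterlim_compose[OF tendsto_exp_minus_T r_lim])
  show "(\<lambda>k. energy \<mu> p (s k) u) \<longlonglongrightarrow> ennreal (2 * a / (p * (p + 1)))"
  proof (rule tendsto_sandwich[OF always_eventually always_eventually])
    show "\<forall>k. ennreal (?K * (a * exp (- (1 / T (r k))) - exp (- T (r k)))) \<le> energy \<mu> p (s k) u"
      using energy_at_log_scale(1)[OF p] a by (metis s_def)
    show "\<forall>k. energy \<mu> p (s k) u
        \<le> ennreal (?K * (a + 1 - exp (- (1 / T (r k))) + exp (- T (r k))) + 60 * s k)"
      using energy_at_log_scale(2)[OF p] a by (metis s_def)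
    have "(\<lambda>k. ?K * (a * exp (- (1 / T (r k))) - exp (- T (r k)))) \<longlonglongrightarrow> ?K * (a * 1 - 0)"
      by (intro tendsto_intros e1 e2)
    then show "(\<lambda>k. ennreal (?K * (a * exp (- (1 / T (r k))) - exp (- T (r k)))))
        \<longlonglongrightarrow> ennreal (2 * a / (p * (p + 1)))"
      by (intro tendsto_ennrealI) simp
    have "(\<lambda>k. ?K * (a + 1 - exp (- (1 / T (r k))) + exp (- T (r k))) + 60 * s k)
        \<longlonglongrightarrow> ?K * (a + 1 - 1 + 0) + 60 * 0"
      by (intro tendsto_intros e1 e2 s_lim)
    then show "(\<lambda>k. ennreal (?K * (a + 1 - exp (- (1 / T (r k))) + exp (- T (r k))) + 60 * s k))
        \<longlonglongrightarrow> ennreal (2 * a / (p * (p + 1)))"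
      by (intro tendsto_ennrealI) simp
  qed
qed

section \<open>The logarithmic volume mean\<close>

text \<open>The ball is the interval from \<open>max 0 (x\<^sub>0 - r)\<close> to \<open>x\<^sub>0 + r\<close>, whose length exceeds \<open>r\<close> by at most \<open>x\<^sub>0\<close>;
  as the weight is at most \<open>2\<close>, this accounts for the term \<open>2 * x\<^sub>0\<close>.\<close>

lemma volume_ball_bounds:
  assumes "0 \<le> x\<^sub>0" "0 < r"
  defines "V \<equiv> measure \<mu> (mball_of \<mu> x\<^sub>0 r)"
  shows "r \<le> V" "V \<le> 4 * r"
    and "x\<^sub>0 + r < exp (T (Suc n)) \<Longrightarrow> \<bar>V - a_seq n * r\<bar> \<le> exp (T n) + 2 * x\<^sub>0"
proof -
  let ?l = "max 0 (x\<^sub>0 - r)"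
  have l: "0 \<le> ?l" "?l \<le> x\<^sub>0 + r" using assms by auto
  have V: "V = measure \<mu> {?l..x\<^sub>0 + r}" unfolding V_def mball_of_mu[OF assms(1)] ..
  show "r \<le> V" "V \<le> 4 * r" using measure_mu_Icc_bounds[OF l] assms(1,2) unfolding V by (auto simp: max_def)
  assume "x\<^sub>0 + r < exp (T (Suc n))"
  from measure_mu_Icc_near[OF l this]
  have 1: "\<bar>V - a_seq n * (x\<^sub>0 + r - ?l)\<bar> \<le> exp (T n)" by (simp only: V)
  have "a_seq n * (x\<^sub>0 - ?l) \<le> 2 * x\<^sub>0" "0 \<le> a_seq n * (x\<^sub>0 - ?l)"
    using assms(1,2) a_seq_bounds[of n] by (auto intro!: mult_mono)
  moreover have "a_seq n * (x\<^sub>0 + r - ?l) = a_seq n * r + a_seq n * (x\<^sub>0 - ?l)"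
    by (simp add: algebra_simps)
  ultimately show "\<bar>V - a_seq n * r\<bar> \<le> exp (T n) + 2 * x\<^sub>0" using 1 by linarith
qed

text \<open>The integral of \<open>a_seq n / r\<close> over \<open>[1, R]\<close> is \<open>a_seq n * ln R\<close>, so it suffices to bound the integral of the
  difference \<open>D\<close> of the two integrands. Up to \<open>A = exp (T n)\<close> the crude bound \<open>3 / r\<close> integrates to
  \<open>3 * T n\<close>. Beyond \<open>A\<close> the bound \<open>(A + 2 * x\<^sub>0) / r\<^sup>2\<close> integrates to at most \<open>1 + 2 * x\<^sub>0\<close>, uniformly
  in \<open>R\<close>.\<close>

lemma log_volume_mean_near:
  assumes x\<^sub>0: "0 \<le> x\<^sub>0" and R: "exp (T n) \<le> R" "x\<^sub>0 + R < exp (T (Suc n))"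
  shows "\<bar>log_volume_mean \<mu> x\<^sub>0 R - a_seq n\<bar> \<le> (3 * T n + 1 + 2 * x\<^sub>0) / ln R"
proof -
  define V where "V r = measure \<mu> (mball_of \<mu> x\<^sub>0 r)" for r
  define A where "A = exp (T n)"
  let ?a = "a_seq n"
  have A: "1 < A" "A \<le> R" using T_ge_2[of n] R by (simp_all add: A_def)
  have lnR: "0 < ln R" using A by simp
  have "mono V"
  proof (rule monoI)
    fix r r' :: real assume le: "r \<le> r'"
    show "V r \<le> V r'"
    proof (cases "0 \<le> r")
      case True
      have "emeasure \<mu> {max 0 (x\<^sub>0 - r')..x\<^sub>0 + r'} \<noteq> \<infinity>"
        using True le x\<^sub>0 emeasure_mu_Icc_eq_measure[of "max 0 (x\<^sub>0 - r')" "x\<^sub>0 + r'"] by simp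
      then show ?thesis
        unfolding V_def mball_of_mu[OF x\<^sub>0] using le
        by (intro measure_mono_fmeasurable)
           (auto simp: fmeasurable_def sets_mu sets_restrict_space_iff less_top)
    next
      case False
      then have "mball_of \<mu> x\<^sub>0 r = {}"
        by (auto simp: mball_of_def) (meson dual_order.trans zero_le_dist)
      then show ?thesis by (simp add: V_def)
    qed
  qed
  then have [measurable]: "V \<in> borel_measurable borel" by (rule borel_measurable_mono)
  have V: "r \<le> V r" "V r \<le> 4 * r" if "1 \<le> r" for r
    using volume_ball_bounds[OF x\<^sub>0, of r] that by (auto simp: V_def)
  have near: "\<bar>V r - ?a * r\<bar> \<le> A + 2 * x\<^sub>0" if "1 \<le> r" "r \<le> R" for r
    using volume_ball_bounds(3)[OF x\<^sub>0, of r n] that R by (auto simp: V_def A_def)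
  have int: "set_integrable lborel {1..R} (\<lambda>r. V r / r * (1 / r))"
    unfolding set_integrable_def
  proof (rule integrableI_bounded_set_indicator[where B = 4])
    show "AE r in lborel. r \<in> {1..R} \<longrightarrow> norm (V r / r * (1 / r)) \<le> 4"
    proof (intro AE_I2 impI)
      fix r assume r: "r \<in> {1..R}"
      have "r * 1 \<le> r * r" using r by (intro mult_left_mono) auto
      moreover have "V r \<le> 4 * r" using V(2)[of r] r by simp
      ultimately have "V r \<le> 4 * (r * r)" by linarith
      then show "norm (V r / r * (1 / r)) \<le> 4" using r V[of r] by (simp add: field_simps)
    qed
  qed (use A in auto)
  note HK = set_borel_integral_eq_integral[OF int]
  define D where "D r = V r / r * (1 / r) - ?a * (1 / r)" for r
  have ln_int: "((\<lambda>r. c * (1 / r)) has_integral (c * (ln y - ln x))) {x..y}" if "1 \<le> x" "x \<le> y" for c x y :: real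
    using that by (intro has_integral_mult_right fundamental_theorem_of_calculus)
      (auto intro!: derivative_eq_intros simp flip: has_real_derivative_iff_has_vector_derivative simp: divide_inverse)
  have inv2: "((\<lambda>r. c * (1 / r\<^sup>2)) has_integral (c * (1 / x - 1 / y))) {x..y}" if "1 \<le> x" "x \<le> y" for c x y :: real
  proof -
    have "((\<lambda>r. 1 / r\<^sup>2) has_integral ((- (1 / y)) - (- (1 / x)))) {x..y}"
      using that by (intro fundamental_theorem_of_calculus)
      (auto intro!: derivative_eq_intros simp flip: has_real_derivative_iff_has_vector_derivative simp: power2_eq_square divide_inverse)
    from has_integral_mult_right[OF this, of c] show ?thesis by simp
  qed
  have a_int: "((\<lambda>r. ?a * (1 / r)) has_integral (?a * ln R)) {1..R}"
    using ln_int[of 1 R ?a] A by simp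
  have D_int: "D integrable_on {1..R}"
    unfolding D_def[abs_def] by (rule integrable_diff[OF HK(1) has_integral_integrable[OF a_int]])
  have "integral {1..R} D = integral {1..R} (\<lambda>r. V r / r * (1 / r)) - ?a * ln R"
    unfolding D_def[abs_def] integral_diff[OF HK(1) has_integral_integrable[OF a_int]]
    by (simp only: integral_unique[OF a_int])
  also have "\<dots> = ln R * (log_volume_mean \<mu> x\<^sub>0 R - ?a)"
    using lnR HK(2) by (simp add: log_volume_mean_def V_def field_simps)
  finally have mean: "ln R * (log_volume_mean \<mu> x\<^sub>0 R - ?a) = integral {1..R} D" ..
  have D_eq: "D r = (V r - ?a * r) / r\<^sup>2" if "1 \<le> r" for r
    using that by (simp add: D_def field_simps power2_eq_square)
  have "norm (integral {1..A} D) \<le> integral {1..A} (\<lambda>r. 3 * (1 / r))"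
  proof (rule Henstock_Kurzweil_Integration.integral_norm_bound_integral)
    show "D integrable_on {1..A}" using A by (intro integrable_on_subinterval[OF D_int]) auto
    show "(\<lambda>r. 3 * (1 / r)) integrable_on {1..A}" using ln_int[of 1 A 3] A by (auto simp: integrable_on_def)
    fix r assume "r \<in> {1..A}"
    then have r: "1 \<le> r" by simp
    have "?a * r \<le> 2 * r" "1 * r \<le> ?a * r" using r a_seq_bounds[of n] by (auto intro: mult_right_mono)
    then have "\<bar>V r - ?a * r\<bar> \<le> 3 * r" using V[OF r] by linarith
    then show "norm (D r) \<le> 3 * (1 / r)"
      using r by (simp add: D_eq field_simps power2_eq_square)
  qed
  also have "\<dots> = 3 * T n" using ln_int[of 1 A 3] A by (simp add: integral_unique A_def)
  finally have first: "\<bar>integral {1..A} D\<bar> \<le> 3 * T n" by simp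
  have "norm (integral {A..R} D) \<le> integral {A..R} (\<lambda>r. (A + 2 * x\<^sub>0) * (1 / r\<^sup>2))"
  proof (rule Henstock_Kurzweil_Integration.integral_norm_bound_integral)
    show "D integrable_on {A..R}" using A by (intro integrable_on_subinterval[OF D_int]) auto
    show "(\<lambda>r. (A + 2 * x\<^sub>0) * (1 / r\<^sup>2)) integrable_on {A..R}"
      using inv2[of A R "A + 2 * x\<^sub>0"] A by (auto simp: integrable_on_def)
    fix r assume "r \<in> {A..R}"
    then have r: "1 \<le> r" "r \<le> R" using A by auto
    show "norm (D r) \<le> (A + 2 * x\<^sub>0) * (1 / r\<^sup>2)"
      using near[OF r] r by (simp add: D_eq divide_right_mono)
  qed
  also have "\<dots> = (A + 2 * x\<^sub>0) * (1 / A - 1 / R)" using inv2[of A R "A + 2 * x\<^sub>0"] A by (simp add: integral_unique)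
  also have "\<dots> \<le> (A + 2 * x\<^sub>0) * (1 / A)" using A x\<^sub>0 by (intro mult_left_mono) auto
  also have "\<dots> = 1 + 2 * x\<^sub>0 / A" using A by (simp add: field_simps)
  also have "\<dots> \<le> 1 + 2 * x\<^sub>0" using A x\<^sub>0 mult_left_mono[of 1 A x\<^sub>0] by (simp add: field_simps)
  finally have second: "\<bar>integral {A..R} D\<bar> \<le> 1 + 2 * x\<^sub>0" by simp
  have "integral {1..R} D = integral {1..A} D + integral {A..R} D"
    using A D_int by (simp add: Henstock_Kurzweil_Integration.integral_combine)
  then have "ln R * \<bar>log_volume_mean \<mu> x\<^sub>0 R - ?a\<bar> \<le> 3 * T n + 1 + 2 * x\<^sub>0"
    using first second lnR unfolding abs_mult_pos'[OF less_imp_le[OF lnR]] mean by linarith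
  then show ?thesis using lnR by (simp add: field_simps)
qed

text \<open>For \<open>R = exp (log_scale m)\<close> the error in the preceding lemma is of order \<open>1 / T m\<close>. Its hypothesis
  holds for large \<open>m\<close> since \<open>2 * log_scale m \<le> T (Suc (Suc m))\<close> leaves room for the base point.\<close>

lemma log_volume_mean_at_log_scale:
  assumes x\<^sub>0: "0 \<le> x\<^sub>0"
  shows "(\<lambda>m. log_volume_mean \<mu> x\<^sub>0 (exp (log_scale m)) - a_seq (Suc m)) \<longlonglongrightarrow> 0"
proof (rule Lim_null_comparison)
  show "(\<lambda>m. 3 * (1 / T m) + (1 + 2 * x\<^sub>0) * (1 / log_scale m)) \<longlonglongrightarrow> 0"
  proof -
    have "(\<lambda>m. 1 / log_scale m) \<longlonglongrightarrow> 0"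
      by (rule tendsto_divide_0[OF tendsto_const filterlim_at_top_imp_at_infinity[OF filterlim_log_scale]])
    then have "(\<lambda>m. 3 * (1 / T m) + (1 + 2 * x\<^sub>0) * (1 / log_scale m)) \<longlonglongrightarrow> 3 * 0 + (1 + 2 * x\<^sub>0) * 0"
      by (intro tendsto_intros tendsto_inverse_T)
    then show ?thesis by simp
  qed
  have "\<forall>\<^sub>F m in sequentially. x\<^sub>0 < exp (log_scale m)"
    using filterlim_compose[OF exp_at_top filterlim_log_scale] by (simp add: filterlim_at_top_dense)
  then show "\<forall>\<^sub>F m in sequentially. norm (log_volume_mean \<mu> x\<^sub>0 (exp (log_scale m)) - a_seq (Suc m))
      \<le> 3 * (1 / T m) + (1 + 2 * x\<^sub>0) * (1 / log_scale m)"
  proof eventually_elim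
    case (elim m)
    let ?L = "log_scale m"
    have T: "T (Suc m) \<le> ?L" "?L + ?L \<le> T (Suc (Suc m))"
    proof -
      have "1 * T (Suc m) \<le> T m * T (Suc m)"
        using T_ge_2[of m] T_ge_2[of "Suc m"] by (intro mult_right_mono) auto
      then show "T (Suc m) \<le> ?L" by (simp add: log_scale_def)
      have "T (Suc (Suc m)) = T m * ?L" by (simp add: log_scale_def T_Suc power2_eq_square)
      moreover have "2 * ?L \<le> T m * ?L"
        using T_ge_2[of m] log_scale_pos[of m] by (intro mult_right_mono) auto
      ultimately show "?L + ?L \<le> T (Suc (Suc m))" by simp
    qed
    have "x\<^sub>0 + exp ?L < 2 * exp ?L" using elim by simp
    also have "\<dots> \<le> exp ?L * exp ?L"
    proof (rule mult_right_mono)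
      show "2 \<le> exp ?L" using log_scale_ge_4[of m] exp_ge_add_one_self[of ?L] by linarith
    qed simp
    also have "\<dots> \<le> exp (T (Suc (Suc m)))" using T(2) by (simp flip: exp_add)
    finally have "\<bar>log_volume_mean \<mu> x\<^sub>0 (exp ?L) - a_seq (Suc m)\<bar> \<le> (3 * T (Suc m) + 1 + 2 * x\<^sub>0) / ?L"
      using log_volume_mean_near[OF x\<^sub>0, of "Suc m" "exp ?L"] T(1) by simp
    also have "\<dots> = 3 * (T (Suc m) / ?L) + (1 + 2 * x\<^sub>0) * (1 / ?L)" by (simp add: add_divide_distrib)
    finally show ?case by (simp add: log_scale_ratios)
  qed
qed

lemma log_volume_mean_tendsto_along_log_scale:
  assumes "0 \<le> x\<^sub>0" "strict_mono r" and a: "\<And>k. a_seq (Suc (r k)) = a"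
  shows "(\<lambda>k. log_volume_mean \<mu> x\<^sub>0 (exp (log_scale (r k)))) \<longlonglongrightarrow> a"
proof -
  have "(\<lambda>k. log_volume_mean \<mu> x\<^sub>0 (exp (log_scale (r k))) - a) \<longlonglongrightarrow> 0"
    using filterlim_compose[OF log_volume_mean_at_log_scale[OF assms(1)] filterlim_subseq[OF assms(2)]]
    by (simp add: a)
  then show ?thesis by (simp add: LIM_zero_iff)
qed

section \<open>Oscillation of the energy and of the mean\<close>

theorem theorem3p1:
  "ahlfors_regular 1 \<mu> \<and>
   (\<forall>p\<ge>1.
      (\<exists>s :: nat \<Rightarrow> real. (\<forall>k. 0 < s k) \<and> (\<forall>k. s (Suc k) < s k) \<and> s \<longlonglongrightarrow> 0 \<and>
         (\<lambda>k. energy \<mu> p (s k) u) \<longlonglongrightarrow> ennreal (2 / (p * (p + 1)))) \<and>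
      (\<exists>s :: nat \<Rightarrow> real. (\<forall>k. 0 < s k) \<and> (\<forall>k. s (Suc k) < s k) \<and> s \<longlonglongrightarrow> 0 \<and>
         (\<lambda>k. energy \<mu> p (s k) u) \<longlonglongrightarrow> ennreal (4 / (p * (p + 1)))) \<and>
      \<not> (\<exists>L :: ennreal. ((\<lambda>s. energy \<mu> p s u) \<longlongrightarrow> L) (at_right 0))) \<and>
   (\<forall>x\<^sub>0\<in>space \<mu>.
      \<not> (\<exists>L :: ereal. ((\<lambda>R. ereal (log_volume_mean \<mu> x\<^sub>0 R)) \<longlongrightarrow> L) at_top))"
proof -
  \<comment> \<open>\<open>log_scale m\<close> sees the stage \<open>Suc m\<close>, so the parities are swapped: odd \<open>m\<close> yields \<open>1\<close>, even \<open>m\<close> yields \<open>2\<close>.\<close>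
  let ?odd = "\<lambda>k::nat. 2 * k + 1" and ?even = "\<lambda>k::nat. 2 * k"
  have mono: "strict_mono ?odd" "strict_mono ?even" by (auto simp: strict_mono_def)
  have a_odd: "a_seq (Suc (?odd k)) = 1" and a_even: "a_seq (Suc (?even k)) = 2" for k
    by (simp_all add: a_seq_def)
  have energy: "(\<exists>s :: nat \<Rightarrow> real. (\<forall>k. 0 < s k) \<and> (\<forall>k. s (Suc k) < s k) \<and> s \<longlonglongrightarrow> 0 \<and>
         (\<lambda>k. energy \<mu> p (s k) u) \<longlonglongrightarrow> ennreal (2 / (p * (p + 1)))) \<and>
      (\<exists>s :: nat \<Rightarrow> real. (\<forall>k. 0 < s k) \<and> (\<forall>k. s (Suc k) < s k) \<and> s \<longlonglongrightarrow> 0 \<and>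
         (\<lambda>k. energy \<mu> p (s k) u) \<longlonglongrightarrow> ennreal (4 / (p * (p + 1)))) \<and>
      \<not> (\<exists>L :: ennreal. ((\<lambda>s. energy \<mu> p s u) \<longlongrightarrow> L) (at_right 0))" if p: "1 \<le> p" for p
  proof -
    define s where "s = (\<lambda>k. 1 / (p * log_scale (?odd k)))"
    define s' where "s' = (\<lambda>k. 1 / (p * log_scale (?even k)))"
    have s: "(\<forall>k. 0 < s k) \<and> (\<forall>k. s (Suc k) < s k) \<and> s \<longlonglongrightarrow> 0 \<and>
        (\<lambda>k. energy \<mu> p (s k) u) \<longlonglongrightarrow> ennreal (2 / (p * (p + 1)))"
      using energy_tendsto_along_log_scale[OF p mono(1) a_odd] unfolding s_def by simp
    have s': "(\<forall>k. 0 < s' k) \<and> (\<forall>k. s' (Suc k) < s' k) \<and> s' \<longlonglongrightarrow> 0 \<and>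
        (\<lambda>k. energy \<mu> p (s' k) u) \<longlonglongrightarrow> ennreal (4 / (p * (p + 1)))"
      using energy_tendsto_along_log_scale[OF p mono(2) a_even] unfolding s'_def by simp
    have "\<not> ((\<lambda>s. energy \<mu> p s u) \<longlongrightarrow> L) (at_right 0)" for L
    proof
      assume L: "((\<lambda>s. energy \<mu> p s u) \<longlongrightarrow> L) (at_right 0)"
      have along: "L = l" if "\<forall>k. 0 < r k" "r \<longlonglongrightarrow> 0" "(\<lambda>k. energy \<mu> p (r k) u) \<longlonglongrightarrow> l"
        for r :: "nat \<Rightarrow> real" and l
      proof (rule LIMSEQ_unique[OF filterlim_compose[OF L] that(3)])
        show "filterlim r (at_right 0) sequentially"
          using that(1,2) by (intro tendsto_imp_filterlim_at_right always_eventually)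
      qed
      have "L = ennreal (2 / (p * (p + 1)))" using s by (intro along[of s]) simp_all
      moreover have "L = ennreal (4 / (p * (p + 1)))" using s' by (intro along[of s']) simp_all
      ultimately have "ennreal (2 / (p * (p + 1))) = ennreal (4 / (p * (p + 1)))" by simp
      then show False using p by (simp add: divide_eq_eq)
    qed
    then show ?thesis by (intro conjI exI[of _ s] exI[of _ s'] s s') blast
  qed
  have mean: "\<not> ((\<lambda>R. ereal (log_volume_mean \<mu> x\<^sub>0 R)) \<longlongrightarrow> L) at_top" if "x\<^sub>0 \<in> space \<mu>" for x\<^sub>0 L
  proof
    assume L: "((\<lambda>R. ereal (log_volume_mean \<mu> x\<^sub>0 R)) \<longlongrightarrow> L) at_top"
    have x0: "0 \<le> x\<^sub>0" using that by (simp add: space_mu)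
    have "ereal a = L" if r: "strict_mono r" and a: "\<And>k. a_seq (Suc (r k)) = a"
      for r :: "nat \<Rightarrow> nat" and a
    proof (rule LIMSEQ_unique)
      have "filterlim (\<lambda>k. exp (log_scale (r k))) at_top sequentially"
        using filterlim_compose[OF exp_at_top filterlim_compose[OF filterlim_log_scale filterlim_subseq[OF r]]] .
      then show "(\<lambda>k. ereal (log_volume_mean \<mu> x\<^sub>0 (exp (log_scale (r k))))) \<longlonglongrightarrow> L"
        by (rule filterlim_compose[OF L])
      show "(\<lambda>k. ereal (log_volume_mean \<mu> x\<^sub>0 (exp (log_scale (r k))))) \<longlonglongrightarrow> ereal a"
        using log_volume_mean_tendsto_along_log_scale[OF x0 r a] by (rule tendsto_ereal)
    qed
    from this[OF mono(1) a_odd] this[OF mono(2) a_even] show False by auto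
  qed
  show ?thesis using ahlfors_regular_mu energy mean by blast
qed

end
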